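(* Let $\tau = \frac{\sqrt5-1}{2}$, so $\tau^2 = \frac{3-\sqrt5}{2}$. Then for every $x\in(0,1)$, $$g_{\tau^2}(x) = \lim_{n\to\infty} \frac{\#\{\xi\in\Xi_n : \xi\le x\}}{\#\Xi_n}.$$
   Context: The mediant of reduced fractions is $\frac{a}{b}\oplus\frac{c}{d} = \frac{a+c}{b+d}$. Stern–Brocot sets: $\mathcal{F}_0=\{0/1,1/1\}$; if $\mathcal{F}_n=\{0=x_{0,n}<\cdots<x_{2^n,n}=1\}$ (reduced fractions), then $\mathcal{F}_{n+1}=\mathcal{F}_n\cup\{x_{j-1,n}\oplus x_{j,n}: 1\le j\le 2^n\}$. For $\lambda\in(0,1)$, the Tichy–Uitz function $g_\lambda:[0,1]\to[0,1]$ is defined by $g_\lambda(0)=0$, $g_\lambda(1)=1$, and for consecutive elements $x_{j-1,n},x_{j,n}$ of $\mathcal{F}_n$, $g_\lambda(x_{j-1,n}\oplus x_{j,n}) = g_\lambda(x_{j-1,n}) + \lambda\,(g_\lambda(x_{j,n})-g_\lambda(x_{j-1,n}))$; this defines $g_\lambda$ on $\mathbb{Q}\cap[0,1]$, extended to $[0,1]$ by continuity. Every rational $x\in(0,1)$ has a unique regular reduced (minus) continued fraction expansion $x = [[1;b_1,\ldots,b_l]] = 1-\cfrac{1}{b_1-\cfrac{1}{b_2-\cdots-\cfrac{1}{b_l}}}$ with integers $b_i\ge 2$; put $L(x)=b_1+\cdots+b_l$. For $k\ge1$ let $\Theta_k=\{x\in\mathbb{Q}\cap(0,1): L(x)=k+1\}$,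 and for $n\ge1$ let $\Xi_n=\{0,1\}\cup\bigcup_{k=1}^n\Theta_k$. *)

theory Defs
  imports Complex_Main "HOL-Library.FuncSet"
begin

definition mediant :: "rat \<Rightarrow> rat \<Rightarrow> rat" where
  "mediant x y = (let (a, b) = quotient_of x; (c, d) = quotient_of y in Fract (a + c) (b + d))"

definition consecutive :: "rat set \<Rightarrow> rat \<Rightarrow> rat \<Rightarrow> bool" where
  "consecutive S x y \<longleftrightarrow> x \<in> S \<and> y \<in> S \<and> x < y \<and> (\<forall>z\<in>S. \<not> (x < z \<and> z < y))"

primrec stern_brocot :: "nat \<Rightarrow> rat set" where
  "stern_brocot 0 = {0, 1}"
| "stern_brocot (Suc n) =
     stern_brocot n \<union> {mediant x y | x y. consecutive (stern_brocot n) x y}"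

definition is_tichy_uitz :: "real \<Rightarrow> (real \<Rightarrow> real) \<Rightarrow> bool" where
  "is_tichy_uitz \<alpha> g \<longleftrightarrow>
     g 0 = 0 \<and> g 1 = 1 \<and>
     (\<forall>n x y. consecutive (stern_brocot n) x y \<longrightarrow>
        g (of_rat (mediant x y)) = g (of_rat x) + \<alpha> * (g (of_rat y) - g (of_rat x))) \<and>
     continuous_on {0..1} g"

(* The Stern-Brocot sets exhaust the rationals in [0,1], so for 0 < \<alpha> < 1 the recursion and
   continuity determine the function on [0,1]; outside [0,1] its value is fixed to be undefined.
   For other \<alpha> the definition is not meaningful. *)
definition tichy_uitz :: "real \<Rightarrow> real \<Rightarrow> real" where
  "tichy_uitz \<alpha> = (THE g. g \<in> {0..1} \<rightarrow>\<^sub>E {0..1} \<and> is_tichy_uitz \<alpha> g)"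

(* b1 - 1/(b2 - ... - 1/bl); the value at the empty list is irrelevant. *)
fun minus_cf_tail :: "nat list \<Rightarrow> rat" where
  "minus_cf_tail [] = 0"
| "minus_cf_tail [b] = of_nat b"
| "minus_cf_tail (b # c # bs) = of_nat b - 1 / minus_cf_tail (c # bs)"

definition minus_cf :: "nat list \<Rightarrow> rat" where
  "minus_cf bs = 1 - 1 / minus_cf_tail bs"

(* The partial quotients b1, ..., bl (without the leading 1); meaningful for 0 < x < 1. *)
definition minus_cf_digits :: "rat \<Rightarrow> nat list" where
  "minus_cf_digits x = (THE bs. bs \<noteq> [] \<and> (\<forall>b\<in>set bs. b \<ge> 2) \<and> x = minus_cf bs)"

definition digit_sum :: "rat \<Rightarrow> nat" where
  "digit_sum x = sum_list (minus_cf_digits x)"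

definition Theta :: "nat \<Rightarrow> rat set" where
  "Theta k = {x. 0 < x \<and> x < 1 \<and> digit_sum x = k + 1}"

definition Xi :: "nat \<Rightarrow> rat set" where
  "Xi n = {0, 1} \<union> (\<Union>k\<in>{1..n}. Theta k)"

end

theory Submission
  imports Defs "HOL-Analysis.Uniform_Limit"
begin

text \<open>The maps \<open>A x = x / (1 + x)\<close> and \<open>B x = 1 / (2 - x)\<close> carry \<open>[0, 1]\<close> onto \<open>[0, 1/2]\<close> and
  \<open>[1/2, 1]\<close>. On minus continued fractions \<open>A\<close> prepends the digit 2 and \<open>B\<close> increases the first digit
  by one, so they raise the digit sum by 2 and by 1; both commute with the mediant, so each
  Stern--Brocot set is the union of the images of the previous one. Hence \<open>g\<^sub>\<lambda>\<close> is the continuous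
  solution of \<open>g (A x) = \<lambda> g x\<close> and \<open>g (B x) = \<lambda> + (1 - \<lambda>) g x\<close>, while the number \<open>c\<^sub>n x\<close> of
  rationals in \<open>(0, x]\<close> with digit sum at most \<open>n + 1\<close> satisfies \<open>c\<^sub>n\<^sub>+\<^sub>2 (A x) = c\<^sub>n x\<close> and
  \<open>c\<^sub>n\<^sub>+\<^sub>2 (B x) = c\<^sub>n 1 + 1 + c\<^sub>n\<^sub>+\<^sub>1 x\<close>. For \<open>\<lambda> = \<tau>\<^sup>2\<close> the two recursions match up to a bounded error
  per step, so \<open>c\<^sub>n x - c\<^sub>n 1 * g x\<close> is \<open>O(n)\<close>, whereas \<open>c\<^sub>n 1\<close> grows faster than \<open>n\<close>.\<close>

section \<open>The two branch maps: order, ranges and induction over rationals\<close>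

definition left_branch :: "'a::field \<Rightarrow> 'a" where
  "left_branch x = x / (1 + x)"

definition right_branch :: "'a::field \<Rightarrow> 'a" where
  "right_branch x = 1 / (2 - x)"

lemma of_rat_left_branch:
  "of_rat (left_branch x) = (left_branch (of_rat x) :: 'a::field_char_0)"
  by (simp add: left_branch_def of_rat_divide of_rat_add)

lemma of_rat_right_branch:
  "of_rat (right_branch x) = (right_branch (of_rat x) :: 'a::field_char_0)"
  by (simp add: right_branch_def of_rat_divide of_rat_diff)

lemma left_branch_less_iff:
  fixes x y :: "'a::linordered_field"
  assumes "0 \<le> x" "0 \<le> y"
  shows "left_branch x < left_branch y \<longleftrightarrow> x < y"
proof -
  have "0 < 1 + x" "0 < 1 + y" using assms by (auto intro: add_pos_nonneg)
  then show ?thesis by (simp add: left_branch_def divide_simps algebra_simps)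
qed

lemma right_branch_less_iff:
  fixes x y :: "'a::linordered_field"
  assumes "x \<le> 1" "y \<le> 1"
  shows "right_branch x < right_branch y \<longleftrightarrow> x < y"
proof -
  have "x < 2" "y < 2" using assms by (auto intro: order_le_less_trans)
  then have "0 < 2 - x" "0 < 2 - y" by auto
  then show ?thesis by (simp add: right_branch_def divide_simps)
qed

lemma left_branch_le_iff:
  fixes x y :: "'a::linordered_field"
  assumes "0 \<le> x" "0 \<le> y"
  shows "left_branch x \<le> left_branch y \<longleftrightarrow> x \<le> y"
  using left_branch_less_iff[OF assms(2,1)] by (simp add: linorder_not_less[symmetric])

lemma right_branch_le_iff:
  fixes x y :: "'a::linordered_field"
  assumes "x \<le> 1" "y \<le> 1"
  shows "right_branch x \<le> right_branch y \<longleftrightarrow> x \<le> y"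
  using right_branch_less_iff[OF assms(2,1)] by (simp add: linorder_not_less[symmetric])

lemma branch_endpoints [simp]:
  "left_branch 0 = (0 :: 'a::field_char_0)" "left_branch 1 = (1/2 :: 'a)"
  "right_branch 0 = (1/2 :: 'a)" "right_branch 1 = (1 :: 'a)"
  by (simp_all add: left_branch_def right_branch_def)

lemma left_branch_eq_iff:
  fixes x y :: "'a::linordered_field"
  assumes "0 \<le> x" "0 \<le> y"
  shows "left_branch x = left_branch y \<longleftrightarrow> x = y"
  using left_branch_le_iff[OF assms] left_branch_le_iff[OF assms(2,1)] by (auto simp: order_eq_iff)

lemma right_branch_eq_iff:
  fixes x y :: "'a::linordered_field"
  assumes "x \<le> 1" "y \<le> 1"
  shows "right_branch x = right_branch y \<longleftrightarrow> x = y"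
  using right_branch_le_iff[OF assms] right_branch_le_iff[OF assms(2,1)] by (auto simp: order_eq_iff)

lemma left_branch_bounds:
  fixes x :: "'a::linordered_field"
  shows "0 \<le> x \<Longrightarrow> 0 \<le> left_branch x" "0 < x \<Longrightarrow> 0 < left_branch x"
    "0 \<le> x \<Longrightarrow> x \<le> 1 \<Longrightarrow> left_branch x \<le> 1/2" "0 \<le> x \<Longrightarrow> x < 1 \<Longrightarrow> left_branch x < 1/2"
  using left_branch_less_iff[of 0 x] left_branch_le_iff[of 0 x]
    left_branch_less_iff[of x 1] left_branch_le_iff[of x 1] by auto

lemma right_branch_bounds:
  fixes x :: "'a::linordered_field"
  shows "x \<le> 1 \<Longrightarrow> right_branch x \<le> 1" "x < 1 \<Longrightarrow> right_branch x < 1"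
    "0 \<le> x \<Longrightarrow> x \<le> 1 \<Longrightarrow> 1/2 \<le> right_branch x" "0 < x \<Longrightarrow> x \<le> 1 \<Longrightarrow> 1/2 < right_branch x"
  using right_branch_less_iff[of 0 x] right_branch_le_iff[of 0 x]
    right_branch_less_iff[of x 1] right_branch_le_iff[of x 1] by auto

lemma left_branch_cases:
  fixes x :: "'a::linordered_field"
  assumes "0 \<le> x" "x \<le> 1/2"
  obtains y where "0 \<le> y" "y \<le> 1" "x = left_branch y"
proof
  have "x < 1" using assms(2) by (rule order_le_less_trans) simp
  then show "0 \<le> x / (1 - x)" "x / (1 - x) \<le> 1" "x = left_branch (x / (1 - x))"
    using assms by (auto simp: left_branch_def field_simps)
qed

lemma right_branch_cases:
  fixes x :: "'a::linordered_field"
  assumes "1/2 \<le> x" "x \<le> 1"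
  obtains y where "0 \<le> y" "y \<le> 1" "x = right_branch y"
proof
  have "0 < x" using assms(1) by (rule order_less_le_trans[rotated]) simp
  then show "0 \<le> 2 - 1 / x" "2 - 1 / x \<le> 1" "x = right_branch (2 - 1 / x)"
    using assms by (auto simp: right_branch_def field_simps)
qed

lemma left_branch_divide:
  fixes a b :: "'a::linordered_field"
  assumes "b \<noteq> 0" "a + b \<noteq> 0"
  shows "left_branch (a / b) = a / (a + b)"
  using assms by (simp add: left_branch_def divide_simps algebra_simps)

lemma right_branch_divide:
  fixes a b :: "'a::linordered_field"
  assumes "b \<noteq> 0"
  shows "right_branch (a / b) = b / (2 * b - a)"
proof (cases "2 * b = a")
  case True
  then show ?thesis using assms by (auto simp: right_branch_def)
next
  case False
  then show ?thesis using assms by (simp add: right_branch_def divide_simps)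
qed

text \<open>A subtractive Euclidean algorithm: undoing a branch sends \<open>p / q\<close> to
  \<open>p / (q - p)\<close> when it is below \<open>1/2\<close> and to
  \<open>(2 * p - q) / p\<close> when it is above, and the denominator drops both times. The
  induction runs over arbitrary, possibly unreduced pairs, so coprimality need not be
  tracked.\<close>

lemma rat_branch_induct [consumes 2, case_names half left right]:
  fixes x :: rat
  assumes "0 < x" "x < 1"
    and half: "P (1/2)"
    and left: "\<And>y. 0 < y \<Longrightarrow> y < 1 \<Longrightarrow> P y \<Longrightarrow> P (left_branch y)"
    and right: "\<And>y. 0 < y \<Longrightarrow> y < 1 \<Longrightarrow> P y \<Longrightarrow> P (right_branch y)"
  shows "P x"
proof -
  have main: "P (of_int p / of_int q)" if "0 < p" "p < q" for p q :: int
    using that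
  proof (induction "nat q" arbitrary: p q rule: less_induct)
    case less
    consider "2 * p = q" | "2 * p < q" | "2 * p > q" by linarith
    then show ?case
    proof cases
      case 1
      then have "(of_int p / of_int q :: rat) = 1/2" using less.prems by auto
      then show ?thesis using half by simp
    next
      case 2
      have "P (left_branch (of_int p / of_int (q - p)))"
        using less 2 by (intro left less.hyps) (auto simp: divide_simps simp del: of_int_diff)
      moreover have "left_branch (of_int p / of_int (q - p)) = (of_int p / of_int q :: rat)"
        using less.prems 2 by (simp add: left_branch_def field_simps)
      ultimately show ?thesis by simp
    next
      case 3
      have "P (right_branch (of_int (2 * p - q) / of_int p))"
        using less 3 by (intro right less.hyps) (auto simp: divide_simps simp del: of_int_diff)
      moreover have "right_branch (of_int (2 * p - q) / of_int p) = (of_int p / of_int q :: rat)"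
        using less.prems 3 by (simp add: right_branch_def field_simps)
      ultimately show ?thesis by simp
    qed
  qed
  obtain p q where pq: "quotient_of x = (p, q)" by fastforce
  then have "x = of_int p / of_int q" "q > 0"
    by (simp_all add: quotient_of_div quotient_of_denom_pos)
  moreover from this have "0 < p" "p < q"
    using assms(1,2) by (auto simp: zero_less_divide_iff divide_less_eq_1)
  ultimately show ?thesis using main[of p q] by simp
qed

subsection \<open>Continued fraction digits\<close>

definition cf_digits :: "nat list \<Rightarrow> bool" where
  "cf_digits bs \<longleftrightarrow> bs \<noteq> [] \<and> (\<forall>b\<in>set bs. b \<ge> 2)"

lemma minus_cf_tail_gt_1: "cf_digits bs \<Longrightarrow> minus_cf_tail bs > 1"
proof (induction bs rule: minus_cf_tail.induct)
  case (3 b c bs)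
  then have *: "minus_cf_tail (c # bs) > 1" "(2::nat) \<le> b" by (auto simp: cf_digits_def)
  have "(2::rat) \<le> of_nat b" using *(2) by (metis of_nat_le_iff of_nat_numeral)
  moreover have "1 / minus_cf_tail (c # bs) < 1" using *(1) by simp
  ultimately show ?case by simp
qed (auto simp: cf_digits_def)

lemma minus_cf_bounds:
  assumes "cf_digits bs" shows "0 < minus_cf bs" "minus_cf bs < 1"
  using minus_cf_tail_gt_1[OF assms] by (auto simp: minus_cf_def)

lemma minus_cf_singleton_2: "minus_cf [2] = 1/2"
  by (simp add: minus_cf_def)

text \<open>With \<open>t\<close> the tail value of \<open>bs\<close>,
  \<open>1 - 1 / (2 - 1 / t)\<close> equals \<open>u / (1 + u)\<close> for
  \<open>u = 1 - 1 / t\<close>. The tail bound \<open>t > 1\<close> keeps all denominators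
  nonzero.\<close>

lemma minus_cf_Cons_2:
  assumes "cf_digits bs" shows "minus_cf (2 # bs) = left_branch (minus_cf bs)"
proof -
  obtain c cs where "bs = c # cs" using assms by (cases bs) (auto simp: cf_digits_def)
  then show ?thesis using minus_cf_tail_gt_1[OF assms]
    by (simp add: minus_cf_def left_branch_def field_simps)
qed

text \<open>Raising the first digit turns the tail value \<open>t\<close> into \<open>t + 1\<close>,
  and \<open>1 - 1 / (t + 1) = 1 / (2 - (1 - 1 / t))\<close>.\<close>

lemma minus_cf_Cons_Suc:
  assumes "cf_digits (b # bs)"
  shows "minus_cf (Suc b # bs) = right_branch (minus_cf (b # bs))"
proof -
  have *: "minus_cf_tail (Suc b # bs) = 1 + minus_cf_tail (b # bs)"
    by (cases bs) auto
  show ?thesis using minus_cf_tail_gt_1[OF assms]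
    unfolding minus_cf_def right_branch_def * by (simp add: field_simps)
qed

text \<open>The counterpart on digit lists of the three cases of
  \<open>rat_branch_induct\<close>.\<close>

lemma cf_digits_cases:
  assumes "cf_digits bs"
  obtains "bs = [2]" | cs where "cf_digits cs" "bs = 2 # cs"
  | c cs where "cf_digits (c # cs)" "bs = Suc c # cs"
proof -
  obtain b ds where bs: "bs = b # ds" using assms by (cases bs) (auto simp: cf_digits_def)
  show ?thesis
  proof (cases "b = 2")
    case True
    then show ?thesis using that(1) that(2)[of ds] bs assms
      by (cases ds) (auto simp: cf_digits_def)
  next
    case False
    then have "2 \<le> b - 1" "b = Suc (b - 1)" using assms bs by (auto simp: cf_digits_def)
    then show ?thesis using that(3)[of "b - 1" ds] bs assms
      by (auto simp: cf_digits_def)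
  qed
qed

text \<open>The value of an expansion lies at, left of or right of \<open>1/2\<close> according to how the list begins,
  so the two branches decode it.\<close>

lemma minus_cf_inj:
  assumes "cf_digits bs" "cf_digits cs" "minus_cf bs = minus_cf cs"
  shows "bs = cs"
  using assms
\<comment> \<open>The digit sum is the measure because undoing the right branch only lowers the
  first digit and keeps the length of the list.\<close>
proof (induction "sum_list bs" arbitrary: bs cs rule: less_induct)
  case less
  have lo: "minus_cf (2 # ds) < 1/2" if "cf_digits ds" for ds
    using left_branch_bounds(4)[of "minus_cf ds"] minus_cf_bounds[OF that]
    by (simp add: minus_cf_Cons_2[OF that])
  have hi: "1/2 < minus_cf (Suc d # ds)" if "cf_digits (d # ds)" for d ds
    using right_branch_bounds(4)[of "minus_cf (d # ds)"] minus_cf_bounds[OF that]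
    by (simp add: minus_cf_Cons_Suc[OF that])
  from less.prems(1) show ?case
  proof (cases rule: cf_digits_cases)
    case 1
    from less.prems(2) show ?thesis
      using 1 less.prems(3) lo hi minus_cf_singleton_2
      by (cases rule: cf_digits_cases) (auto simp: order.strict_iff_order)
  next
    case (2 ds)
    from less.prems(2) show ?thesis
    proof (cases rule: cf_digits_cases)
      case 1
      then show ?thesis using 2 less.prems(3) lo minus_cf_singleton_2 by fastforce
    next
      case (2 es)
      have "left_branch (minus_cf ds) = left_branch (minus_cf es)"
        using less.prems(3) \<open>bs = 2 # ds\<close> 2 \<open>cf_digits ds\<close> by (simp add: minus_cf_Cons_2)
      then have "minus_cf ds = minus_cf es"
        using left_branch_eq_iff minus_cf_bounds 2(1) \<open>cf_digits ds\<close> by (meson less_imp_le)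
      then show ?thesis using less.hyps[of ds es] 2 \<open>bs = 2 # ds\<close> \<open>cf_digits ds\<close> by simp
    next
      case (3 e es)
      then show ?thesis using 2 less.prems(3) lo hi by (metis order.asym)
    qed
  next
    case (3 d ds)
    from less.prems(2) show ?thesis
    proof (cases rule: cf_digits_cases)
      case 1
      then show ?thesis using 3 less.prems(3) hi minus_cf_singleton_2 by fastforce
    next
      case (2 es)
      then show ?thesis using 3 less.prems(3) lo hi by (metis order.asym)
    next
      case (3 e es)
      have "right_branch (minus_cf (d # ds)) = right_branch (minus_cf (e # es))"
        using less.prems(3) \<open>bs = Suc d # ds\<close> 3 \<open>cf_digits (d # ds)\<close> by (simp add: minus_cf_Cons_Suc)
      then have "minus_cf (d # ds) = minus_cf (e # es)"
        using right_branch_eq_iff minus_cf_bounds 3(1) \<open>cf_digits (d # ds)\<close> by (meson less_imp_le)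
      then show ?thesis using less.hyps[of "d # ds" "e # es"] 3 \<open>bs = Suc d # ds\<close> \<open>cf_digits (d # ds)\<close>
        by simp
    qed
  qed
qed

text \<open>Building a rational from \<open>1/2\<close> by branches builds its digit list from
  \<open>[2]\<close> at the same time.\<close>

lemma minus_cf_surj:
  assumes "0 < x" "x < 1"
  shows "\<exists>bs. cf_digits bs \<and> x = minus_cf bs"
  using assms
proof (induction rule: rat_branch_induct)
  case half
  have "cf_digits [2]" by (simp add: cf_digits_def)
  then show ?case using minus_cf_singleton_2 by metis
next
  case (left y)
  then obtain bs where "cf_digits bs" "y = minus_cf bs" by blast
  then have "cf_digits (2 # bs)" "left_branch y = minus_cf (2 # bs)"
    by (simp_all add: minus_cf_Cons_2) (simp add: cf_digits_def)
  then show ?case by blast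
next
  case (right y)
  then obtain bs where bs: "cf_digits bs" "y = minus_cf bs" by blast
  then obtain c cs where "bs = c # cs" by (cases bs) (auto simp: cf_digits_def)
  then have "cf_digits (Suc c # cs)" "right_branch y = minus_cf (Suc c # cs)"
    using bs minus_cf_Cons_Suc by (auto simp: cf_digits_def)
  then show ?case by blast
qed

lemma minus_cf_digits_minus_cf:
  assumes "cf_digits bs" shows "minus_cf_digits (minus_cf bs) = bs"
  unfolding minus_cf_digits_def
  by (rule the_equality) (use assms minus_cf_inj in \<open>auto simp: cf_digits_def\<close>)

lemma digit_sum_minus_cf: "cf_digits bs \<Longrightarrow> digit_sum (minus_cf bs) = sum_list bs"
  by (simp add: digit_sum_def minus_cf_digits_minus_cf)

lemma digit_sum_half: "digit_sum (1/2) = 2"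
  using digit_sum_minus_cf[of "[2]"] by (simp add: minus_cf_singleton_2 cf_digits_def)

lemma digit_sum_left_branch:
  assumes "0 < x" "x < 1" shows "digit_sum (left_branch x) = digit_sum x + 2"
proof -
  obtain bs where bs: "cf_digits bs" "x = minus_cf bs" using minus_cf_surj[OF assms] by blast
  then have "cf_digits (2 # bs)" by (simp add: cf_digits_def)
  then show ?thesis using bs digit_sum_minus_cf by (simp add: minus_cf_Cons_2[symmetric])
qed

lemma digit_sum_right_branch:
  assumes "0 < x" "x < 1" shows "digit_sum (right_branch x) = digit_sum x + 1"
proof -
  obtain bs where bs: "cf_digits bs" "x = minus_cf bs" using minus_cf_surj[OF assms] by blast
  then obtain c cs where c: "bs = c # cs" by (cases bs) (auto simp: cf_digits_def)
  then have "cf_digits (Suc c # cs)" using bs by (auto simp: cf_digits_def)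
  then show ?thesis using bs c digit_sum_minus_cf by (simp add: minus_cf_Cons_Suc[symmetric])
qed

lemma digit_sum_ge_2:
  assumes "0 < x" "x < 1" shows "2 \<le> digit_sum x"
  using assms
  by (induction rule: rat_branch_induct)
    (auto simp: digit_sum_half digit_sum_left_branch digit_sum_right_branch)

subsection \<open>Counting\<close>

text \<open>This is \<open>Xi n\<close> without its endpoints, which have no expansion. On the open
  interval the branch recursion for the digit sum holds without exceptions.\<close>

definition Theta_upto :: "nat \<Rightarrow> rat set" where
  "Theta_upto n = {x. 0 < x \<and> x < 1 \<and> digit_sum x \<le> n + 1}"

lemma Xi_eq: "Xi n = {0, 1} \<union> Theta_upto n"
proof -
  have "(\<Union>k\<in>{1..n}. Theta k) = Theta_upto n"
  proof (intro equalityI subsetI)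
    fix x assume "x \<in> Theta_upto n"
    \<comment> \<open>The index is at least 1 because no digit sum is below 2, so the union starting
      at \<open>k = 1\<close> misses nothing.\<close>
    then have "x \<in> Theta (digit_sum x - 1)" "digit_sum x - 1 \<in> {1..n}"
      using digit_sum_ge_2[of x] by (auto simp: Theta_upto_def Theta_def)
    then show "x \<in> (\<Union>k\<in>{1..n}. Theta k)" by blast
  qed (auto simp: Theta_def Theta_upto_def)
  then show ?thesis by (simp add: Xi_def)
qed

lemma rat_branch_cases:
  fixes x :: rat
  assumes "0 < x" "x < 1"
  obtains "x = 1/2" | y where "0 < y" "y < 1" "x = left_branch y"
  | y where "0 < y" "y < 1" "x = right_branch y"
  using assms(1,2) that by (induction rule: rat_branch_induct) blast+

lemma Theta_upto_0: "Theta_upto 0 = {}"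
  using digit_sum_ge_2 by (fastforce simp: Theta_upto_def)

lemma Theta_upto_1: "Theta_upto (Suc 0) = {1/2}"
proof -
  have "x = 1/2" if "x \<in> Theta_upto (Suc 0)" for x
  proof -
    from that have "0 < x" "x < 1" "digit_sum x \<le> 2" by (auto simp: Theta_upto_def)
    from this(1,2) show ?thesis
      using \<open>digit_sum x \<le> 2\<close> digit_sum_ge_2
      by (cases rule: rat_branch_cases)
         (fastforce simp: digit_sum_left_branch digit_sum_right_branch)+
  qed
  then show ?thesis by (auto simp: Theta_upto_def digit_sum_half)
qed

text \<open>The left branch costs 2 and the right branch costs 1 of the digit sum. This asymmetry
  produces the Fibonacci-type recursion, and with it the golden ratio.\<close>

lemma Theta_upto_Suc_Suc:
  "Theta_upto (Suc (Suc n)) =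
     insert (1/2) (left_branch ` Theta_upto n \<union> right_branch ` Theta_upto (Suc n))"
proof (intro equalityI subsetI)
  fix x assume "x \<in> Theta_upto (Suc (Suc n))"
  then have "0 < x" "x < 1" "digit_sum x \<le> n + 3" by (auto simp: Theta_upto_def)
  from this(1,2)
  show "x \<in> insert (1/2) (left_branch ` Theta_upto n \<union> right_branch ` Theta_upto (Suc n))"
    using \<open>digit_sum x \<le> n + 3\<close>
    by (cases rule: rat_branch_cases)
       (auto simp: Theta_upto_def digit_sum_left_branch digit_sum_right_branch)
next
  fix x assume "x \<in> insert (1/2) (left_branch ` Theta_upto n \<union> right_branch ` Theta_upto (Suc n))"
  moreover have "left_branch y < 1" "0 < right_branch y" if "0 < y" "y < 1" for y :: rat
    using left_branch_bounds(4)[of y] right_branch_bounds(4)[of y] that by linarith+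
  ultimately show "x \<in> Theta_upto (Suc (Suc n))"
    using digit_sum_half
    by (auto simp: Theta_upto_def digit_sum_left_branch digit_sum_right_branch
        simp del: eq_divide_eq_numeral1 intro: left_branch_bounds right_branch_bounds)
qed

lemma finite_Theta_upto: "finite (Theta_upto n)"
  by (induction n rule: induct_nat_012) (auto simp: Theta_upto_0 Theta_upto_1 Theta_upto_Suc_Suc)

definition theta_count :: "nat \<Rightarrow> real \<Rightarrow> nat" where
  "theta_count n x = card {\<xi> \<in> Theta_upto n. of_rat \<xi> \<le> x}"

text \<open>Below \<open>1/2\<close> only left images are counted. At \<open>x = 1\<close> the
  formula would be off by one, since \<open>left_branch 1\<close> is the point \<open>1/2\<close>,
  which is itself counted.\<close>

lemma theta_count_left:
  assumes "0 \<le> x" "x < 1"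
  shows "theta_count (Suc (Suc n)) (left_branch x) = theta_count n x"
proof -
  have x: "left_branch x < 1/2" using left_branch_bounds(4) assms by blast
  have "{\<xi> \<in> Theta_upto (Suc (Suc n)). of_rat \<xi> \<le> left_branch x}
     = left_branch ` {\<xi> \<in> Theta_upto n. of_rat \<xi> \<le> x}" (is "?L = ?R")
  proof -
    have half: "\<not> of_rat (1/2) \<le> left_branch x"
      using x by (simp add: of_rat_divide)
    have right: "\<not> of_rat (right_branch \<xi>) \<le> left_branch x" if "\<xi> \<in> Theta_upto (Suc n)" for \<xi>
    proof -
      have "1/2 < (of_rat (right_branch \<xi>) :: real)"
        unfolding of_rat_right_branch using that
        by (intro right_branch_bounds(4)) (auto simp: Theta_upto_def)
      then show ?thesis using x by linarith
    qed
    have left: "of_rat (left_branch \<xi>) \<le> left_branch x \<longleftrightarrow> of_rat \<xi> \<le> x"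
      if "\<xi> \<in> Theta_upto n" for \<xi>
      unfolding of_rat_left_branch
      by (rule left_branch_le_iff) (use that assms in \<open>auto simp: Theta_upto_def\<close>)
    show ?thesis unfolding Theta_upto_Suc_Suc using half right left by blast
  qed
  moreover have "inj_on left_branch {\<xi> \<in> Theta_upto n. of_rat \<xi> \<le> x}"
    by (intro inj_onI) (auto simp: Theta_upto_def left_branch_eq_iff)
  ultimately show ?thesis by (simp add: theta_count_def card_image)
qed

lemma theta_count_1: "theta_count n 1 = card (Theta_upto n)"
proof -
  have "{\<xi> \<in> Theta_upto n. of_rat \<xi> \<le> (1::real)} = Theta_upto n"
    by (auto simp: Theta_upto_def)
  then show ?thesis by (simp add: theta_count_def)
qed

text \<open>From \<open>1/2\<close> on, all left images and the point \<open>1/2\<close> lie below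
  the threshold, which gives the first two summands.\<close>

lemma theta_count_right:
  assumes "0 \<le> x" "x \<le> 1"
  shows "theta_count (Suc (Suc n)) (right_branch x) =
    card (Theta_upto n) + 1 + theta_count (Suc n) x"
proof -
  let ?R = "{\<xi> \<in> Theta_upto (Suc n). of_rat \<xi> \<le> x}"
  have x: "1/2 \<le> right_branch x" using right_branch_bounds(3) assms by blast
  have lhalf: "left_branch \<xi> < 1/2" if "\<xi> \<in> Theta_upto n" for \<xi>
    using that left_branch_bounds(4)[of \<xi>] by (simp add: Theta_upto_def)
  have rhalf: "1/2 < right_branch \<xi>" if "\<xi> \<in> Theta_upto (Suc n)" for \<xi>
    using that right_branch_bounds(4)[of \<xi>] by (simp add: Theta_upto_def)
  have half: "of_rat (1/2) \<le> right_branch x"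
    using x by (simp add: of_rat_divide)
  have left: "of_rat (left_branch \<xi>) \<le> right_branch x" if "\<xi> \<in> Theta_upto n" for \<xi>
  proof -
    have "(of_rat (left_branch \<xi>) :: real) < of_rat (1/2)"
      using lhalf[OF that] by (simp only: of_rat_less)
    then show ?thesis using half by linarith
  qed
  have right: "of_rat (right_branch \<xi>) \<le> right_branch x \<longleftrightarrow> of_rat \<xi> \<le> x"
    if "\<xi> \<in> Theta_upto (Suc n)" for \<xi>
    unfolding of_rat_right_branch
    by (rule right_branch_le_iff) (use that assms in \<open>auto simp: Theta_upto_def\<close>)
  have "{\<xi> \<in> Theta_upto (Suc (Suc n)). of_rat \<xi> \<le> right_branch x}
     = insert (1/2) (left_branch ` Theta_upto n \<union> right_branch ` ?R)"
    unfolding Theta_upto_Suc_Suc using half right left by blast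
  moreover have "card (insert (1/2) (left_branch ` Theta_upto n \<union> right_branch ` ?R))
      = Suc (card (left_branch ` Theta_upto n \<union> right_branch ` ?R))"
    using lhalf rhalf finite_Theta_upto by (subst card_insert_disjoint) fastforce+
  moreover have "card (left_branch ` Theta_upto n \<union> right_branch ` ?R)
      = card (left_branch ` Theta_upto n) + card (right_branch ` ?R)"
    using lhalf rhalf finite_Theta_upto by (intro card_Un_disjoint) (auto, fastforce)
  moreover have "inj_on left_branch (Theta_upto n)" "inj_on right_branch ?R"
    by (auto intro!: inj_onI simp: Theta_upto_def left_branch_eq_iff right_branch_eq_iff)
  ultimately show ?thesis by (simp add: theta_count_def card_image)
qed

text \<open>The counting recursion at 1, the fixed point of the right branch.\<close>

lemma card_Theta_upto_Suc_Suc: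
  "card (Theta_upto (Suc (Suc n))) = card (Theta_upto n) + card (Theta_upto (Suc n)) + 1"
  using theta_count_right[of 1 n] by (simp add: theta_count_1)

text \<open>Quadratic growth suffices to beat the linear error in
  \<open>theta_count_deviation\<close>; the true exponential rate is not pursued.\<close>

lemma card_Theta_upto_ge: "n\<^sup>2 \<le> 4 * card (Theta_upto n)"
proof (induction n rule: induct_nat_012)
  case (ge2 n)
  \<comment> \<open>The induction step amounts to \<open>4 * n \<le> (n + 1)\<^sup>2\<close>, that
    is, \<open>(n - 1)\<^sup>2\<close> is nonnegative.\<close>
  have "int (2 * n) \<le> int (n\<^sup>2 + 1)"
    using zero_le_power2[of "int n - 1"] by (simp add: power2_eq_square algebra_simps)
  then have "2 * n \<le> n\<^sup>2 + 1" by (simp only: of_nat_le_iff)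
  then show ?case using ge2 by (simp add: card_Theta_upto_Suc_Suc power2_eq_square)
qed (auto simp: Theta_upto_0 Theta_upto_1)

subsection \<open>Self-similarity of the Stern--Brocot sets\<close>

text \<open>The mediant is read off reduced fractions, so reducedness has to survive the branch. It
  does because \<open>(a, b)\<close> is mapped to \<open>(a, a + b)\<close> by an integer matrix of
  determinant 1.\<close>

lemma quotient_of_left_branch:
  assumes "quotient_of x = (a, b)" "0 \<le> x"
  shows "quotient_of (left_branch x) = (a, a + b)"
proof -
  have b: "b > 0" and co: "coprime a b" and x: "x = of_int a / of_int b"
    using assms(1) by (auto intro: quotient_of_denom_pos quotient_of_coprime quotient_of_div)
  then have a: "a \<ge> 0" using assms(2) by (simp add: zero_le_divide_iff)
  have "(of_int b + of_int a :: rat) \<noteq> 0"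
    using a b by (metis add_nonneg_eq_0_iff less_imp_le less_irrefl of_int_0_eq_iff of_int_add)
  then have "left_branch x = Fract a (a + b)"
    using b x by (simp add: left_branch_divide Fract_of_int_quotient add.commute)
  moreover have "coprime a (a + b)"
    using co by (auto intro!: coprimeI elim: coprime_common_divisor simp: dvd_add_right_iff)
  ultimately show ?thesis using a b by (simp add: quotient_of_Fract normalize_stable)
qed

text \<open>Again a matrix of determinant 1, with rows \<open>(0, 1)\<close> and
  \<open>(-1, 2)\<close>.\<close>

lemma quotient_of_right_branch:
  assumes "quotient_of x = (a, b)" "x \<le> 1"
  shows "quotient_of (right_branch x) = (b, 2 * b - a)"
proof -
  have b: "b > 0" and co: "coprime a b" and x: "x = of_int a / of_int b"
    using assms(1) by (auto intro: quotient_of_denom_pos quotient_of_coprime quotient_of_div)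
  then have a: "a \<le> b" using assms(2) by (simp add: divide_le_eq_1)
  then have "(of_int (2 * b - a) :: rat) \<noteq> 0" using b by (subst of_int_eq_0_iff) simp
  then have "right_branch x = Fract b (2 * b - a)"
    using b x by (simp add: right_branch_divide Fract_of_int_quotient)
  moreover have "coprime b (2 * b - a)"
  proof (rule coprimeI)
    fix c assume "c dvd b" "c dvd 2 * b - a"
    then have "c dvd a" using dvd_diff[of c "2 * b" "2 * b - a"] by simp
    then show "is_unit c" using co \<open>c dvd b\<close> coprime_common_divisor by fastforce
  qed
  ultimately show ?thesis using a b by (simp add: quotient_of_Fract normalize_stable)
qed

text \<open>The mediant adds the vectors of numerator and denominator, and the branch acts on them
  linearly. The sum vector may be unreduced, which is harmless because
  \<open>left_branch_divide\<close> accepts any quotient.\<close>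

lemma mediant_left_branch:
  assumes "0 \<le> x" "0 \<le> y"
  shows "mediant (left_branch x) (left_branch y) = left_branch (mediant x y)"
proof -
  obtain a b c d where q: "quotient_of x = (a, b)" "quotient_of y = (c, d)" by fastforce
  have pos: "b > 0" "d > 0" using q quotient_of_denom_pos by auto
  have "a \<ge> 0" "c \<ge> 0" using assms q pos
    by (auto dest!: quotient_of_div simp: zero_le_divide_iff)
  then have "a + b + (c + d) > 0" using pos by linarith
  then have nz: "(of_int (a + c) + of_int (b + d) :: rat) \<noteq> 0"
    unfolding of_int_add[symmetric] by (subst of_int_eq_0_iff) linarith
  have "(of_int (b + d) :: rat) \<noteq> 0" using pos by (subst of_int_eq_0_iff) linarith
  from left_branch_divide[OF this nz] show ?thesis
    using q quotient_of_left_branch[OF q(1) assms(1)] quotient_of_left_branch[OF q(2) assms(2)]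
    by (simp add: mediant_def Fract_of_int_quotient algebra_simps)
qed

lemma mediant_right_branch:
  assumes "x \<le> 1" "y \<le> 1"
  shows "mediant (right_branch x) (right_branch y) = right_branch (mediant x y)"
proof -
  obtain a b c d where q: "quotient_of x = (a, b)" "quotient_of y = (c, d)" by fastforce
  have "b > 0" "d > 0" using q quotient_of_denom_pos by auto
  then have "(of_int (b + d) :: rat) \<noteq> 0" by (subst of_int_eq_0_iff) linarith
  from right_branch_divide[OF this] show ?thesis
    using q quotient_of_right_branch[OF q(1) assms(1)] quotient_of_right_branch[OF q(2) assms(2)]
    by (simp add: mediant_def Fract_of_int_quotient algebra_simps)
qed

text \<open>The two images meet only at \<open>1/2\<close>, the common image of the endpoints 1 and
  0. Hence no consecutive pair straddles \<open>1/2\<close>, and within each half the branch is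
  strictly increasing.\<close>

lemma consecutive_branches_iff:
  assumes S: "S \<subseteq> {0..1}" "0 \<in> S" "1 \<in> S"
  shows "consecutive (left_branch ` S \<union> right_branch ` S) u v \<longleftrightarrow>
    (\<exists>x y. consecutive S x y \<and>
      (u = left_branch x \<and> v = left_branch y \<or> u = right_branch x \<and> v = right_branch y))"
    (is "consecutive ?T u v \<longleftrightarrow> ?rhs")
proof
  have le: "left_branch z \<le> 1/2" "1/2 \<le> right_branch z" if "z \<in> S" for z
    using that S left_branch_bounds(3)[of z] right_branch_bounds(3)[of z] by auto
  have L: "left_branch x < left_branch y \<longleftrightarrow> x < y" if "x \<in> S" "y \<in> S" for x y
    by (rule left_branch_less_iff) (use that S in auto)
  have R: "right_branch x < right_branch y \<longleftrightarrow> x < y" if "x \<in> S" "y \<in> S" for x y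
    by (rule right_branch_less_iff) (use that S in auto)
  {
    assume c: "consecutive ?T u v"
    have half: "1/2 \<in> left_branch ` S" "1/2 \<in> right_branch ` S"
      using imageI[OF S(3), of left_branch] imageI[OF S(2), of right_branch] by simp_all
    \<comment> \<open>A right image that is at most \<open>1/2\<close> must be \<open>1/2\<close>,
      which is also a left image, and symmetrically.\<close>
    have side: "z \<le> 1/2 \<Longrightarrow> z \<in> left_branch ` S" "1/2 \<le> z \<Longrightarrow> z \<in> right_branch ` S"
      if "z \<in> ?T" for z
      using that half le by (metis Un_iff image_iff order_antisym)+
    from c have uv: "u \<in> ?T" "v \<in> ?T" "u < v" by (auto simp: consecutive_def)
    have "1/2 \<in> ?T" using half by blast
    with c have "\<not> (u < 1/2 \<and> 1/2 < v)" unfolding consecutive_def by blast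
    then consider "u \<le> 1/2" "v \<le> 1/2" | "1/2 \<le> u" "1/2 \<le> v" using uv(3) by linarith
    then show ?rhs
    proof cases
      case 1
      then obtain x y where xy: "x \<in> S" "y \<in> S" "u = left_branch x" "v = left_branch y"
        using side(1)[OF uv(1)] side(1)[OF uv(2)] by blast
      have "\<not> (x < z \<and> z < y)" if "z \<in> S" for z
        using c imageI[OF that, of left_branch] L[OF xy(1) that] L[OF that xy(2)] xy(3,4)
        by (auto simp: consecutive_def)
      then have "consecutive S x y" using xy uv(3) L by (auto simp: consecutive_def)
      then show ?thesis using xy by blast
    next
      case 2
      then obtain x y where xy: "x \<in> S" "y \<in> S" "u = right_branch x" "v = right_branch y"
        using side(2)[OF uv(1)] side(2)[OF uv(2)] by blast
      have "\<not> (x < z \<and> z < y)" if "z \<in> S" for z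
        using c imageI[OF that, of right_branch] R[OF xy(1) that] R[OF that xy(2)] xy(3,4)
        by (auto simp: consecutive_def)
      then have "consecutive S x y" using xy uv(3) R by (auto simp: consecutive_def)
      then show ?thesis using xy by blast
    qed
  next
    assume ?rhs
    then obtain x y where c: "consecutive S x y" and
      uv: "u = left_branch x \<and> v = left_branch y \<or> u = right_branch x \<and> v = right_branch y"
      by blast
    have xy: "x \<in> S" "y \<in> S" "x < y" using c by (auto simp: consecutive_def)
    from uv show "consecutive ?T u v"
    proof (elim disjE conjE)
      assume *: "u = left_branch x" "v = left_branch y"
      have "\<not> right_branch z < left_branch y" if "z \<in> S" for z
        using le[OF that] le[OF xy(2)] by linarith
      then show ?thesis using c * L xy by (auto simp: consecutive_def)
    next
      assume *: "u = right_branch x" "v = right_branch y"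
      have "\<not> right_branch x < left_branch z" if "z \<in> S" for z
        using le[OF that] le[OF xy(1)] by linarith
      then show ?thesis using c * R xy by (auto simp: consecutive_def)
    qed
  }
qed

lemma consecutive_0_1: "consecutive {0, 1} x y \<longleftrightarrow> x = 0 \<and> y = 1"
  by (auto simp: consecutive_def)

lemma mediant_0_1: "mediant 0 1 = 1/2"
  by (simp add: mediant_def Fract_of_int_quotient)

text \<open>The range and the endpoints are proved together with the decomposition because the
  induction step needs them to apply \<open>consecutive_branches_iff\<close>.\<close>

lemma stern_brocot_branches:
  "stern_brocot n \<subseteq> {0..1} \<and> 0 \<in> stern_brocot n \<and> 1 \<in> stern_brocot n \<and>
   stern_brocot (Suc n) = left_branch ` stern_brocot n \<union> right_branch ` stern_brocot n"
proof (induction n)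
  case 0
  have "{mediant x y |x y. consecutive {0, 1} x y} = {mediant 0 1}"
    unfolding consecutive_0_1 by blast
  then have "{mediant x y |x y. consecutive {0, 1} x y} = {1/2}" unfolding mediant_0_1 .
  then show ?case by auto
next
  case (Suc n)
  let ?S = "stern_brocot n" and ?T = "stern_brocot (Suc n)"
  let ?M = "{mediant x y |x y. consecutive ?S x y}"
  from Suc have S: "?S \<subseteq> {0..1}" "0 \<in> ?S" "1 \<in> ?S"
    and T: "?T = left_branch ` ?S \<union> right_branch ` ?S" by auto
  have "{mediant u v |u v. consecutive ?T u v} = left_branch ` ?M \<union> right_branch ` ?M"
  proof -
    have "mediant (left_branch x) (left_branch y) = left_branch (mediant x y)"
      "mediant (right_branch x) (right_branch y) = right_branch (mediant x y)"
      if "consecutive ?S x y" for x y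
      using that S by (auto simp: consecutive_def intro!: mediant_left_branch mediant_right_branch)
    then have *: "consecutive ?S x y \<Longrightarrow> left_branch (mediant x y) = mediant (left_branch x) (left_branch y)"
      "consecutive ?S x y \<Longrightarrow> right_branch (mediant x y) = mediant (right_branch x) (right_branch y)"
      for x y by simp_all
    show ?thesis unfolding T
    proof (intro equalityI subsetI)
      fix m assume "m \<in> {mediant u v |u v. consecutive (left_branch ` ?S \<union> right_branch ` ?S) u v}"
      then obtain u v x y where "m = mediant u v" "consecutive ?S x y"
        "u = left_branch x \<and> v = left_branch y \<or> u = right_branch x \<and> v = right_branch y"
        unfolding consecutive_branches_iff[OF S] by blast
      then show "m \<in> left_branch ` ?M \<union> right_branch ` ?M" using *[symmetric] by blast
    next
      fix m assume "m \<in> left_branch ` ?M \<union> right_branch ` ?M"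
      then obtain x y where "consecutive ?S x y"
        "m = left_branch (mediant x y) \<or> m = right_branch (mediant x y)" by blast
      then show "m \<in> {mediant u v |u v. consecutive (left_branch ` ?S \<union> right_branch ` ?S) u v}"
        unfolding consecutive_branches_iff[OF S] using * by blast
    qed
  qed
  then have "stern_brocot (Suc (Suc n)) =
      (left_branch ` ?S \<union> right_branch ` ?S) \<union> (left_branch ` ?M \<union> right_branch ` ?M)"
    using T by (metis stern_brocot.simps(2))
  also have "\<dots> = left_branch ` (?S \<union> ?M) \<union> right_branch ` (?S \<union> ?M)" by blast
  finally have "stern_brocot (Suc (Suc n)) = left_branch ` ?T \<union> right_branch ` ?T" by simp
  moreover have "?T \<subseteq> {0..1}"
  proof -
    have "left_branch z \<in> {0..1}" "right_branch z \<in> {0..1}" if "z \<in> ?S" for z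
    proof -
      have "0 \<le> z" "z \<le> 1" using that S by auto
      then show "left_branch z \<in> {0..1}" "right_branch z \<in> {0..1}"
        using left_branch_bounds(1,3)[of z] right_branch_bounds(1,3)[of z] by auto
    qed
    then show ?thesis unfolding T by blast
  qed
  moreover have "0 \<in> ?T" "1 \<in> ?T" using S by simp_all
  ultimately show ?case by blast
qed

lemmas stern_brocot_subset = stern_brocot_branches[THEN conjunct1]
lemmas stern_brocot_0_1 = stern_brocot_branches[THEN conjunct2, THEN conjunct1]
  stern_brocot_branches[THEN conjunct2, THEN conjunct2, THEN conjunct1]
lemmas stern_brocot_Suc =
  stern_brocot_branches[THEN conjunct2, THEN conjunct2, THEN conjunct2]

lemma rat_in_stern_brocot:
  assumes "0 \<le> x" "x \<le> 1"
  shows "\<exists>n. x \<in> stern_brocot n"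
proof (cases "x = 0 \<or> x = 1")
  case True
  then show ?thesis using stern_brocot_0_1 by blast
next
  case False
  then have "0 < x" "x < 1" using assms by auto
  then show ?thesis
  proof (induction rule: rat_branch_induct)
    case half
    have "left_branch 1 \<in> stern_brocot (Suc 0)" using stern_brocot_Suc stern_brocot_0_1 by blast
    then show ?case by (auto simp del: stern_brocot.simps)
  qed (metis Un_iff image_eqI stern_brocot_Suc)+
qed

subsection \<open>The Tichy--Uitz function as a fixed point\<close>

text \<open>Iterates, started at the identity, of the operator whose fixed point is the Tichy--Uitz
  function. The arguments \<open>x / (1 - x)\<close> and \<open>2 - 1 / x\<close> are the inverse
  branches.\<close>

primrec refine :: "real \<Rightarrow> nat \<Rightarrow> real \<Rightarrow> real" where
  "refine \<alpha> 0 x = x"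
| "refine \<alpha> (Suc n) x =
     (if x \<le> 1/2 then \<alpha> * refine \<alpha> n (x / (1 - x)) else \<alpha> + (1 - \<alpha>) * refine \<alpha> n (2 - 1 / x))"

lemma refine_endpoints: "refine \<alpha> n 0 = 0" "refine \<alpha> n 1 = 1"
  by (induction n) auto

lemma refine_range:
  assumes "0 < \<alpha>" "\<alpha> < 1" "x \<in> {0..1}"
  shows "refine \<alpha> n x \<in> {0..1}"
  using assms(3)
proof (induction n arbitrary: x)
  case (Suc n)
  show ?case
  proof (cases "x \<le> 1/2")
    case True
    then have "x / (1 - x) \<in> {0..1}" using Suc.prems by (auto simp: field_simps)
    from Suc.IH[OF this] show ?thesis using True assms by (auto intro: mult_le_one)
  next
    case False
    then have "2 - 1 / x \<in> {0..1}" using Suc.prems by (auto simp: field_simps)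
    from Suc.IH[OF this] have "0 \<le> (1 - \<alpha>) * refine \<alpha> n (2 - 1 / x)"
      "(1 - \<alpha>) * refine \<alpha> n (2 - 1 / x) \<le> 1 - \<alpha>"
      using assms by (auto intro: mult_left_le)
    then show ?thesis using False assms unfolding atLeastAtMost_iff refine.simps if_not_P[OF False]
      by linarith
  qed
qed simp

text \<open>Each application of the operator contracts distances by
  \<open>max \<alpha> (1 - \<alpha>)\<close>, and the first two iterates differ by at most 1 since
  both take values in the unit interval.\<close>

lemma refine_diff:
  assumes "0 < \<alpha>" "\<alpha> < 1" "x \<in> {0..1}"
  shows "\<bar>refine \<alpha> (Suc n) x - refine \<alpha> n x\<bar> \<le> max \<alpha> (1 - \<alpha>) ^ n"
  using assms(3)
proof (induction n arbitrary: x)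
  case 0
  then show ?case
    using refine_range[OF assms(1,2) 0, of "Suc 0"] refine_range[OF assms(1,2) 0, of 0]
    by (auto simp del: refine.simps simp: abs_le_iff)
next
  case (Suc n)
  have step: "\<bar>c * u - c * v\<bar> \<le> max \<alpha> (1 - \<alpha>) ^ Suc n"
    if "0 \<le> c" "c \<le> max \<alpha> (1 - \<alpha>)" "\<bar>u - v\<bar> \<le> max \<alpha> (1 - \<alpha>) ^ n" for c u v
  proof -
    have "\<bar>c * u - c * v\<bar> = c * \<bar>u - v\<bar>"
      using that(1) by (simp add: abs_mult right_diff_distrib[symmetric])
    also have "\<dots> \<le> max \<alpha> (1 - \<alpha>) * max \<alpha> (1 - \<alpha>) ^ n"
      using that by (intro mult_mono) auto
    finally show ?thesis by simp
  qed
  show ?case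
  proof (cases "x \<le> 1/2")
    case True
    then have "x / (1 - x) \<in> {0..1}" using Suc.prems by (auto simp: field_simps)
    from step[OF _ _ Suc.IH[OF this], of \<alpha>] show ?thesis
      using True assms by (subst (1 2) refine.simps(2)) simp
  next
    case False
    then have "2 - 1 / x \<in> {0..1}" using Suc.prems by (auto simp: field_simps)
    from step[OF _ _ Suc.IH[OF this], of "1 - \<alpha>"] show ?thesis
      using False assms by (subst (1 2) refine.simps(2)) simp
  qed
qed

lemma continuous_on_refine:
  "continuous_on {0..1} (refine \<alpha> n)"
proof (induction n)
  case 0
  have "refine \<alpha> 0 = (\<lambda>x. x)" by auto
  then show ?case by (simp add: continuous_on_id)
next
  case (Suc n)
  have L: "continuous_on {0..1/2} (\<lambda>x. \<alpha> * refine \<alpha> n (x / (1 - x)))"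
    by (intro continuous_intros continuous_on_compose2[OF Suc]) (auto simp: field_simps)
  have R: "continuous_on {1/2..1} (\<lambda>x. \<alpha> + (1 - \<alpha>) * refine \<alpha> n (2 - 1 / x))"
    by (intro continuous_intros continuous_on_compose2[OF Suc]) (auto simp: field_simps)
  have "continuous_on ({0..1/2} \<union> {1/2..1}) (\<lambda>x. if x \<le> 1/2 then \<alpha> * refine \<alpha> n (x / (1 - x))
      else \<alpha> + (1 - \<alpha>) * refine \<alpha> n (2 - 1 / x))"
  proof (rule continuous_on_cases)
    show "\<forall>x. x \<in> {0..1/2} \<and> \<not> x \<le> 1/2 \<or> x \<in> {1/2..1} \<and> x \<le> 1/2 \<longrightarrow>
        \<alpha> * refine \<alpha> n (x / (1 - x)) = \<alpha> + (1 - \<alpha>) * refine \<alpha> n (2 - 1 / x)"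
    proof (intro allI impI)
      fix x :: real
      assume "x \<in> {0..1/2} \<and> \<not> x \<le> 1/2 \<or> x \<in> {1/2..1} \<and> x \<le> 1/2"
      \<comment> \<open>Here the inverse branches give 1 and 0, where \<open>refine\<close> is
        known, so both formulas yield \<open>\<alpha>\<close>.\<close>
      then have x: "x = 1/2" by auto
      show "\<alpha> * refine \<alpha> n (x / (1 - x)) = \<alpha> + (1 - \<alpha>) * refine \<alpha> n (2 - 1 / x)"
        unfolding x by (simp add: refine_endpoints)
    qed
  qed (use L R in auto)
  moreover have "{0..1/2} \<union> {1/2..1} = {0..1::real}" by auto
  moreover have "refine \<alpha> (Suc n) = (\<lambda>x. if x \<le> 1/2 then \<alpha> * refine \<alpha> n (x / (1 - x))
      else \<alpha> + (1 - \<alpha>) * refine \<alpha> n (2 - 1 / x))"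
    by auto
  ultimately show ?case by metis
qed

lemma refine_left_branch:
  assumes "0 \<le> x" "x \<le> 1"
  shows "refine \<alpha> (Suc n) (left_branch x) = \<alpha> * refine \<alpha> n x"
proof -
  have "left_branch x / (1 - left_branch x) = x"
    using assms by (simp add: left_branch_def field_simps)
  then show ?thesis using left_branch_bounds(3)[OF assms] by simp
qed

lemma refine_right_branch:
  assumes "0 \<le> x" "x \<le> 1"
  shows "refine \<alpha> (Suc n) (right_branch x) = \<alpha> + (1 - \<alpha>) * refine \<alpha> n x"
proof (cases "x = 0")
  \<comment> \<open>The image of 0 is \<open>1/2\<close>, which falls under the first clause of
    \<open>refine\<close>; the value there is \<open>\<alpha>\<close> as well.\<close>
  case True
  then show ?thesis by (simp add: refine_endpoints)
next
  case False
  have "2 - 1 / right_branch x = x"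
    using assms by (simp add: right_branch_def)
  then show ?thesis using right_branch_bounds(4)[of x] False assms by simp
qed

text \<open>The iterates are the partial sums of a telescoping series dominated by a geometric one.
  Their uniform limit is continuous and inherits both functional equations.\<close>

lemma branch_fixed_point:
  assumes \<alpha>: "0 < \<alpha>" "\<alpha> < 1"
  obtains G :: "real \<Rightarrow> real" where
    "continuous_on {0..1} G" "\<forall>x\<in>{0..1}. G x \<in> {0..1}" "G 0 = 0" "G 1 = 1"
    "\<forall>x\<in>{0..1}. G (left_branch x) = \<alpha> * G x"
    "\<forall>x\<in>{0..1}. G (right_branch x) = \<alpha> + (1 - \<alpha>) * G x"
proof -
  define M where "M n = max \<alpha> (1 - \<alpha>) ^ n" for n
  define f where "f n x = refine \<alpha> (Suc n) x - refine \<alpha> n x" for n x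
  define G where "G x = x + suminf (\<lambda>n. f n x)" for x
  have "summable M"
    unfolding M_def by (rule summable_geometric) (use \<alpha> in auto)
  then have "uniform_limit {0..1} (\<lambda>n x. \<Sum>i<n. f i x) (\<lambda>x. suminf (\<lambda>i. f i x)) sequentially"
    using refine_diff[OF \<alpha>] by (intro Weierstrass_m_test) (auto simp: f_def M_def simp del: refine.simps)
  then have "uniform_limit {0..1} (\<lambda>n x. x + (\<Sum>i<n. f i x)) G sequentially"
    unfolding G_def by (intro uniform_limit_intros)
  moreover have "x + (\<Sum>i<n. f i x) = refine \<alpha> n x" for n x
    unfolding f_def by (subst sum_lessThan_telescope) simp
  ultimately have lim: "uniform_limit {0..1} (refine \<alpha>) G sequentially"
    by simp
  then have pt: "(\<lambda>n. refine \<alpha> n x) \<longlonglongrightarrow> G x" if "x \<in> {0..1}" for x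
    using that by (rule tendsto_uniform_limitI)
  then have ptS: "(\<lambda>n. refine \<alpha> (Suc n) x) \<longlonglongrightarrow> G x" if "x \<in> {0..1}" for x
    using that LIMSEQ_Suc by blast
  show thesis
  proof
    show "continuous_on {0..1} G"
      by (rule uniform_limit_theorem[OF _ lim]) (auto intro: always_eventually continuous_on_refine)
    show "\<forall>x\<in>{0..1}. G x \<in> {0..1}"
    proof
      fix x :: real assume x: "x \<in> {0..1}"
      show "G x \<in> {0..1}"
        by (rule closed_sequentially[OF _ _ pt[OF x]]) (use refine_range \<alpha> x in auto)
    qed
    show "G 0 = 0" "G 1 = 1"
      using pt[of 0] pt[of 1] by (simp_all add: refine_endpoints LIMSEQ_const_iff)
    have "G (left_branch x) = \<alpha> * G x \<and> G (right_branch x) = \<alpha> + (1 - \<alpha>) * G x"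
      if x: "x \<in> {0..1}" for x
    proof -
      have "left_branch x \<in> {0..1}" "right_branch x \<in> {0..1}"
        using x left_branch_bounds[of x] right_branch_bounds[of x] by auto
      \<comment> \<open>The shifted sequence is used because stage \<open>Suc n\<close> at a branch
        point is an affine function of stage \<open>n\<close> at \<open>x\<close>.\<close>
      note lims = this[THEN ptS]
      have "(\<lambda>n. \<alpha> * refine \<alpha> n x) \<longlonglongrightarrow> \<alpha> * G x"
        "(\<lambda>n. \<alpha> + (1 - \<alpha>) * refine \<alpha> n x) \<longlonglongrightarrow> \<alpha> + (1 - \<alpha>) * G x"
        by (intro tendsto_intros pt x)+
      then show "G (left_branch x) = \<alpha> * G x \<and> G (right_branch x) = \<alpha> + (1 - \<alpha>) * G x"
        using lims x by (auto simp: refine_left_branch refine_right_branch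
            simp del: refine.simps intro: LIMSEQ_unique)
    qed
    then show "\<forall>x\<in>{0..1}. G (left_branch x) = \<alpha> * G x"
      "\<forall>x\<in>{0..1}. G (right_branch x) = \<alpha> + (1 - \<alpha>) * G x" by auto
  qed
qed

text \<open>A consecutive pair of level \<open>n + 1\<close> is the branch image of one of level
  \<open>n\<close>, and so is its mediant. Both functional equations are affine in the value of
  \<open>G\<close>, hence carry the mediant rule up one level.\<close>

lemma is_tichy_uitz_fixed_point:
  assumes G: "continuous_on {0..1} G" "G 0 = 0" "G 1 = 1"
    and L: "\<And>x. x \<in> {0..1} \<Longrightarrow> G (left_branch x) = \<alpha> * G x"
    and R: "\<And>x. x \<in> {0..1} \<Longrightarrow> G (right_branch x) = \<alpha> + (1 - \<alpha>) * G x"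
  shows "is_tichy_uitz \<alpha> G"
proof -
  have "G (of_rat (mediant x y)) = G (of_rat x) + \<alpha> * (G (of_rat y) - G (of_rat x))"
    if "consecutive (stern_brocot n) x y" for n x y
    using that
  proof (induction n arbitrary: x y)
    case 0
    then show ?case
      using L[of 1] G by (simp add: consecutive_0_1 mediant_0_1 of_rat_divide)
  next
    case (Suc n)
    let ?S = "stern_brocot n"
    note S = stern_brocot_subset stern_brocot_0_1
    obtain u v where c: "consecutive ?S u v" and
      *: "x = left_branch u \<and> y = left_branch v \<or> x = right_branch u \<and> y = right_branch v"
      using Suc.prems unfolding stern_brocot_Suc consecutive_branches_iff[OF S] by blast
    have uv: "u \<in> ?S" "v \<in> ?S" using c by (auto simp: consecutive_def)
    have "mediant u v \<in> stern_brocot (Suc n)" using c by auto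
    then have bds: "u \<in> {0..1}" "v \<in> {0..1}" "mediant u v \<in> {0..1}"
      using uv stern_brocot_subset by blast+
    then have rbds: "real_of_rat u \<in> {0..1}" "real_of_rat v \<in> {0..1}" "real_of_rat (mediant u v) \<in> {0..1}"
      by auto
    from * show ?case
    proof (elim disjE conjE)
      assume "x = left_branch u" "y = left_branch v"
      then show ?thesis using bds rbds
        by (simp add: mediant_left_branch of_rat_left_branch L Suc.IH[OF c])
          (simp add: algebra_simps)
    next
      assume "x = right_branch u" "y = right_branch v"
      then show ?thesis using bds rbds
        by (simp add: mediant_right_branch of_rat_right_branch R Suc.IH[OF c])
          (simp add: algebra_simps)
    qed
  qed
  then show ?thesis using G by (simp add: is_tichy_uitz_def)
qed

text \<open>The mediant rule fixes the values on every Stern--Brocot set, hence on all rationals of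
  the interval; density and continuity do the rest.\<close>

lemma is_tichy_uitz_unique:
  assumes g: "is_tichy_uitz \<alpha> g" and h: "is_tichy_uitz \<alpha> h" and x: "x \<in> {0..1}"
  shows "g x = h x"
proof -
  have sb: "g (of_rat q) = h (of_rat q)" if "q \<in> stern_brocot n" for q n
    using that
  proof (induction n arbitrary: q)
    case 0
    then show ?case using g h by (auto simp: is_tichy_uitz_def)
  next
    case (Suc n)
    then consider "q \<in> stern_brocot n"
      | u v where "q = mediant u v" "consecutive (stern_brocot n) u v" by auto
    then show ?case
    proof cases
      case 2
      then have "g (of_rat u) = h (of_rat u)" "g (of_rat v) = h (of_rat v)"
        using Suc.IH by (auto simp: consecutive_def)
      then show ?thesis using 2 g h by (auto simp: is_tichy_uitz_def)
    qed (rule Suc.IH)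
  qed
  have rats: "g r - h r = 0" if "r \<in> \<rat> \<inter> {0..1}" for r
  proof -
    from that have "r \<in> \<rat>" by blast
    then obtain q where q: "r = of_rat q" by (rule Rats_cases)
    then have "0 \<le> q" "q \<le> 1" using that by auto
    then obtain n where "q \<in> stern_brocot n" using rat_in_stern_brocot by blast
    then show ?thesis using sb q by simp
  qed
  have "{0..1} \<subseteq> closure (\<rat> \<inter> {0..1::real})"
  proof
    fix y :: real assume y: "y \<in> {0..1}"
    show "y \<in> closure (\<rat> \<inter> {0..1})"
      unfolding closure_approachable
    proof (intro allI impI)
      fix e :: real assume "e > 0"
      show "\<exists>r\<in>\<rat> \<inter> {0..1}. dist r y < e"
      \<comment> \<open>Approximation is from above, which would leave the interval at
        \<open>y = 1\<close>; there the point itself serves.\<close>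
      proof (cases "y = 1")
        case True
        then show ?thesis using \<open>e > 0\<close> by (intro bexI[of _ 1]) auto
      next
        case False
        then have "y < min 1 (y + e)" using y \<open>e > 0\<close> by auto
        then obtain r where "r \<in> \<rat>" "y < r" "r < min 1 (y + e)" using Rats_dense_in_real by blast
        then show ?thesis using y by (intro bexI[of _ r]) (auto simp: dist_real_def)
      qed
    qed
  qed
  moreover have "closure (\<rat> \<inter> {0..1::real}) \<subseteq> {0..1}"
    by (rule closure_minimal) auto
  ultimately have cl: "closure (\<rat> \<inter> {0..1::real}) = {0..1}" by blast
  have "continuous_on (closure (\<rat> \<inter> {0..1})) (\<lambda>x. g x - h x)"
    unfolding cl using g h by (auto simp: is_tichy_uitz_def intro: continuous_on_diff)
  from continuous_constant_on_closure[OF this rats] show ?thesis using x cl by simp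
qed

lemma tichy_uitz_eq:
  assumes G: "is_tichy_uitz \<alpha> G" "\<And>x. x \<in> {0..1} \<Longrightarrow> G x \<in> {0..1}" and x: "x \<in> {0..1}"
  shows "tichy_uitz \<alpha> x = G x"
proof -
  have "tichy_uitz \<alpha> = restrict G {0..1}"
    unfolding tichy_uitz_def
  proof (rule the_equality, intro conjI)
    \<comment> \<open>All points occurring in the mediant rule lie in the interval, so restricting
      \<open>G\<close> does not disturb the rule.\<close>
    have "mediant u v \<in> {0..1}" "u \<in> {0..1}" "v \<in> {0..1}"
      if "consecutive (stern_brocot n) u v" for u v n
    proof -
      have "mediant u v \<in> stern_brocot (Suc n)" using that by auto
      then show "mediant u v \<in> {0..1}" using stern_brocot_subset by blast
      show "u \<in> {0..1}" "v \<in> {0..1}"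
        using that subsetD[OF stern_brocot_subset[of n]] unfolding consecutive_def by blast+
    qed
    moreover have "continuous_on {0..1} (restrict G {0..1}) \<longleftrightarrow> continuous_on {0..1} G"
      by (rule continuous_on_cong) auto
    ultimately show "is_tichy_uitz \<alpha> (restrict G {0..1})"
      using G(1) by (simp add: is_tichy_uitz_def)
  next
    show "g = restrict G {0..1}" if "g \<in> {0..1} \<rightarrow>\<^sub>E {0..1} \<and> is_tichy_uitz \<alpha> g" for g
    proof (rule extensionalityI[of _ "{0..1}"])
      show "g \<in> extensional {0..1}" using that by (simp add: PiE_iff)
      show "g y = restrict G {0..1} y" if "y \<in> {0..1}" for y
        using is_tichy_uitz_unique[OF _ G(1) that] \<open>_ \<and> is_tichy_uitz \<alpha> g\<close> that by simp
    qed simp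
  qed (use G(2) in auto)
  then show ?thesis using x by simp
qed

subsection \<open>Convergence of the counting ratios\<close>

text \<open>The deviation \<open>N n - \<tau> * N (n + 1)\<close> is multiplied by \<open>-\<tau>\<close>, up to the shift by \<open>-\<tau>\<close>, at each
  step, because \<open>1 - \<tau> = \<tau>\<^sup>2\<close>.\<close>

lemma card_Theta_upto_deviation:
  fixes \<tau> :: real
  assumes \<tau>: "0 < \<tau>" "\<tau> \<le> 2/3" "\<tau>\<^sup>2 = 1 - \<tau>"
  shows "\<bar>real (card (Theta_upto n)) - \<tau> * real (card (Theta_upto (Suc n)))\<bar> \<le> 2"
proof (induction n)
  case 0
  then show ?case using \<tau> by (simp add: Theta_upto_0 Theta_upto_1)
next
  case (Suc n)
  define e where "e = real (card (Theta_upto n)) - \<tau> * real (card (Theta_upto (Suc n)))"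
  have "real (card (Theta_upto (Suc n))) - \<tau> * real (card (Theta_upto (Suc (Suc n)))) = - \<tau> * e - \<tau>"
  proof -
    have "(1 - \<tau> - \<tau>\<^sup>2) * real (card (Theta_upto (Suc n))) = 0" using \<tau>(3) by simp
    then show ?thesis
      by (simp add: e_def card_Theta_upto_Suc_Suc algebra_simps power2_eq_square)
  qed
  \<comment> \<open>The bound 2 reproduces itself, since \<open>2/3 * 2 + 2/3 = 2\<close>.\<close>
  moreover have "\<bar>\<tau> * e\<bar> \<le> 2/3 * 2"
    unfolding abs_mult using \<tau> Suc by (intro mult_mono) (auto simp: e_def)
  ultimately show ?case using \<tau> by linarith
qed

text \<open>A left step goes back two indices and adds an error of at most 4. A right step goes back
  one index and adds at most \<open>4 + 1 + 2 = 7\<close>, the slope in the bound.\<close>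

lemma theta_count_deviation:
  fixes \<tau> :: real
  assumes \<tau>: "0 < \<tau>" "\<tau> \<le> 2/3" "\<tau>\<^sup>2 = 1 - \<tau>"
    and G01: "\<And>x. x \<in> {0..1} \<Longrightarrow> G x \<in> {0..1}" and G1: "G 1 = 1"
    and L: "\<And>x. x \<in> {0..1} \<Longrightarrow> G (left_branch x) = \<tau>\<^sup>2 * G x"
    and R: "\<And>x. x \<in> {0..1} \<Longrightarrow> G (right_branch x) = \<tau>\<^sup>2 + (1 - \<tau>\<^sup>2) * G x"
    and x: "x \<in> {0..1}"
  shows "\<bar>real (theta_count n x) - real (card (Theta_upto n)) * G x\<bar> \<le> 7 * real n"
  using x
proof (induction n arbitrary: x rule: induct_nat_012)
  case 0
  then show ?case by (simp add: theta_count_def Theta_upto_0)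
next
  case 1
  have "theta_count (Suc 0) x \<le> card {1/2 :: rat}"
    unfolding theta_count_def Theta_upto_1 by (rule card_mono) auto
  then show ?case using G01[OF 1] by (auto simp: Theta_upto_1)
next
  case (ge2 n)
  define N where "N k = real (card (Theta_upto k))" for k
  have N: "N (Suc (Suc n)) = N n + N (Suc n) + 1" by (simp add: N_def card_Theta_upto_Suc_Suc)
  have dev: "\<bar>N n - \<tau> * N (Suc n)\<bar> \<le> 2" "\<bar>N (Suc n) - \<tau> * N (Suc (Suc n))\<bar> \<le> 2"
    unfolding N_def by (rule card_Theta_upto_deviation[OF \<tau>])+
  have "\<bar>\<tau> * (N (Suc n) - \<tau> * N (Suc (Suc n)))\<bar> \<le> 1 * 2"
    unfolding abs_mult using \<tau> dev by (intro mult_mono) auto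
  \<comment> \<open>Two successive ratio deviations are chained, which gives the bound
    \<open>2 + 2\<close>.\<close>
  moreover have "N n - \<tau>\<^sup>2 * N (Suc (Suc n)) =
      (N n - \<tau> * N (Suc n)) + \<tau> * (N (Suc n) - \<tau> * N (Suc (Suc n)))"
    by (simp add: algebra_simps power2_eq_square)
  ultimately have dev2: "\<bar>N n - \<tau>\<^sup>2 * N (Suc (Suc n))\<bar> \<le> 4" using dev by linarith
  have shrink: "\<bar>d * G y\<bar> \<le> b" if "\<bar>d\<bar> \<le> b" "y \<in> {0..1}" for d b y
  proof -
    have "\<bar>d\<bar> * \<bar>G y\<bar> \<le> b * 1" using that G01[of y] by (intro mult_mono) auto
    then show ?thesis by (simp add: abs_mult)
  qed
  consider "x = 1" | "x < 1/2" | "1/2 \<le> x" by linarith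
  then show ?case
  proof cases
    case 1
    then show ?thesis by (simp add: theta_count_1 G1)
  next
    case 2
    then obtain y where y: "0 \<le> y" "y \<le> 1" "x = left_branch y"
      using left_branch_cases[of x] ge2.prems by auto
    \<comment> \<open>This meets the strict hypothesis of \<open>theta_count_left\<close>; the point
      \<open>x = 1/2\<close> is handled by the right branch.\<close>
    then have "y \<noteq> 1" using 2 by auto
    then have "real (theta_count (Suc (Suc n)) x) - N (Suc (Suc n)) * G x =
      (real (theta_count n y) - N n * G y) + (N n - \<tau>\<^sup>2 * N (Suc (Suc n))) * G y"
      using y L[of y] theta_count_left[of y] by (simp add: algebra_simps)
    moreover have "\<bar>real (theta_count n y) - N n * G y\<bar> \<le> 7 * real n"
      unfolding N_def using ge2.IH(1) y by simp
    moreover have "\<bar>(N n - \<tau>\<^sup>2 * N (Suc (Suc n))) * G y\<bar> \<le> 4" using shrink dev2 y by simp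
    ultimately show ?thesis unfolding N_def[symmetric] by simp
  next
    case 3
    then obtain y where y: "0 \<le> y" "y \<le> 1" "x = right_branch y"
      using right_branch_cases[of x] ge2.prems by auto
    \<comment> \<open>This is where the parameter matters: the weight of the right branch becomes
      \<open>\<tau>\<close>, the limiting ratio of successive counts.\<close>
    have "1 - \<tau>\<^sup>2 = \<tau>" using \<tau> by simp
    then have "G x = \<tau>\<^sup>2 + \<tau> * G y" using R[of y] y by simp
    moreover have "real (theta_count (Suc (Suc n)) x) = N n + 1 + real (theta_count (Suc n) y)"
      using y theta_count_right[of y n] by (simp add: N_def)
    ultimately have "real (theta_count (Suc (Suc n)) x) - N (Suc (Suc n)) * G x =
      (N n - \<tau>\<^sup>2 * N (Suc (Suc n))) + 1 + (real (theta_count (Suc n) y) - N (Suc n) * G y)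
        + (N (Suc n) - \<tau> * N (Suc (Suc n))) * G y"
      by (simp add: algebra_simps)
    moreover have "\<bar>real (theta_count (Suc n) y) - N (Suc n) * G y\<bar> \<le> 7 * real (Suc n)"
      unfolding N_def using ge2.IH(2) y by simp
    moreover have "\<bar>(N (Suc n) - \<tau> * N (Suc (Suc n))) * G y\<bar> \<le> 2" using shrink dev y by simp
    moreover have "\<bar>a + 1 + b + c\<bar> \<le> 7 * real (Suc (Suc n))"
      if "\<bar>a\<bar> \<le> 4" "\<bar>b\<bar> \<le> 7 * real (Suc n)" "\<bar>c\<bar> \<le> 2" for a b c :: real
      using that by simp
    ultimately show ?thesis using dev2 unfolding N_def[symmetric] by metis
  qed
qed

lemma card_Xi: "card (Xi n) = card (Theta_upto n) + 2"
proof -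
  have "Xi n = insert 0 (insert 1 (Theta_upto n))" by (simp add: Xi_eq)
  moreover have "0 \<notin> insert 1 (Theta_upto n)" "1 \<notin> Theta_upto n" by (auto simp: Theta_upto_def)
  ultimately show ?thesis using finite_Theta_upto by simp
qed

text \<open>The extra element is 0, as the endpoint 1 lies above \<open>x\<close>.\<close>

lemma card_Xi_le:
  assumes "0 < x" "x < (1::real)"
  shows "card {\<xi> \<in> Xi n. of_rat \<xi> \<le> x} = theta_count n x + 1"
proof -
  have "{\<xi> \<in> Xi n. of_rat \<xi> \<le> x} = insert 0 {\<xi> \<in> Theta_upto n. of_rat \<xi> \<le> x}"
    using assms by (auto simp: Xi_eq)
  moreover have "0 \<notin> {\<xi> \<in> Theta_upto n. of_rat \<xi> \<le> x}" by (auto simp: Theta_upto_def)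
  ultimately show ?thesis using finite_Theta_upto by (simp add: theta_count_def)
qed

theorem theorem1:
  fixes \<tau> :: real
  defines "\<tau> \<equiv> (sqrt 5 - 1) / 2"
  shows "\<tau>\<^sup>2 = (3 - sqrt 5) / 2 \<and>
    (\<forall>x::real. 0 < x \<and> x < 1 \<longrightarrow>
       (\<lambda>n. real (card {\<xi> \<in> Xi n. of_rat \<xi> \<le> x}) / real (card (Xi n)))
         \<longlonglongrightarrow> tichy_uitz (\<tau>\<^sup>2) x)"
proof (intro conjI allI impI)
  show sq: "\<tau>\<^sup>2 = (3 - sqrt 5) / 2"
    by (simp add: \<tau>_def power2_eq_square field_simps)
  then have \<tau>sq: "\<tau>\<^sup>2 = 1 - \<tau>" by (simp add: \<tau>_def field_simps)
  \<comment> \<open>The bound \<open>7/3\<close> is what \<open>\<tau> \<le> 2/3\<close> needs, and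
    it holds because \<open>5 \<le> 49/9\<close>.\<close>
  have "1 < sqrt 5" "sqrt 5 \<le> 7/3"
    by simp (rule real_le_lsqrt; simp add: power2_eq_square)
  then have \<tau>: "0 < \<tau>" "\<tau> \<le> 2/3" by (simp_all add: \<tau>_def)
  then have "0 < \<tau>\<^sup>2" "\<tau>\<^sup>2 < 1" using \<tau>sq by auto
  then obtain G :: "real \<Rightarrow> real" where G: "continuous_on {0..1} G"
    "\<forall>x\<in>{0..1}. G x \<in> {0..1}" "G 0 = 0" "G 1 = 1"
    "\<forall>x\<in>{0..1}. G (left_branch x) = \<tau>\<^sup>2 * G x"
    "\<forall>x\<in>{0..1}. G (right_branch x) = \<tau>\<^sup>2 + (1 - \<tau>\<^sup>2) * G x"
    by (rule branch_fixed_point)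
  fix x :: real assume x: "0 < x \<and> x < 1"
  have tu: "tichy_uitz (\<tau>\<^sup>2) x = G x"
    using G x by (intro tichy_uitz_eq is_tichy_uitz_fixed_point) auto
  define N where "N n = real (card (Theta_upto n))" for n
  define r where "r n = real (card {\<xi> \<in> Xi n. of_rat \<xi> \<le> x}) / real (card (Xi n))" for n
  \<comment> \<open>The constant comes from \<open>7 * n + 3 \<le> 10 * n\<close> together with
    \<open>n\<^sup>2 \<le> 4 * N n\<close>.\<close>
  have "norm (r n - G x) \<le> 40 / real n" if "n \<ge> 1" for n
  proof -
    have pos: "0 < N n + 2" by (simp add: N_def add_nonneg_pos)
    have "r n = (real (theta_count n x) + 1) / (N n + 2)"
      using x by (simp add: r_def card_Xi card_Xi_le N_def add.commute)
    then have "r n - G x = ((real (theta_count n x) - N n * G x) + 1 - 2 * G x) / (N n + 2)"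
      using pos by (simp add: field_simps)
    moreover have "\<bar>real (theta_count n x) - N n * G x\<bar> \<le> 7 * real n"
      unfolding N_def using \<tau> \<tau>sq G x by (intro theta_count_deviation) auto
    then have "\<bar>(real (theta_count n x) - N n * G x) + 1 - 2 * G x\<bar> \<le> 7 * real n + 3"
      using bspec[OF G(2), of x] x by auto
    ultimately have "\<bar>r n - G x\<bar> \<le> (7 * real n + 3) / (N n + 2)"
      using pos by (simp add: abs_divide divide_right_mono)
    also have "\<dots> \<le> 40 / real n"
    proof -
      have "real (n\<^sup>2) \<le> real (4 * card (Theta_upto n))"
        using card_Theta_upto_ge by (simp only: of_nat_le_iff)
      then have "real n * real n \<le> 4 * N n" by (simp add: N_def power2_eq_square)
      moreover have "real n \<le> real n * real n" using that by simp
      ultimately have "(7 * real n + 3) * real n \<le> 40 * (N n + 2)" by (simp add: algebra_simps)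
      then show ?thesis using pos that by (simp add: divide_simps)
    qed
    finally show ?thesis by simp
  qed
  then have "eventually (\<lambda>n. norm (r n - G x) \<le> 40 / real n) sequentially"
    by (auto simp: eventually_sequentially)
  moreover have "(\<lambda>n. 40 / real n) \<longlonglongrightarrow> 0" by (rule lim_const_over_n)
  ultimately have "(\<lambda>n. r n - G x) \<longlonglongrightarrow> 0" by (rule Lim_null_comparison)
  then show "(\<lambda>n. real (card {\<xi> \<in> Xi n. of_rat \<xi> \<le> x}) / real (card (Xi n)))
      \<longlonglongrightarrow> tichy_uitz (\<tau>\<^sup>2) x"
    unfolding tu r_def[symmetric] by (simp add: LIM_zero_iff)
qed

end
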